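(* Let $\mathbb{N}$ denote the natural numbers. For each $i\in\{1,2,3,4\}$ and each $j\in\mathbb{N}$ let $S_{ij}\subseteq\mathbb{N}$ be a set with $|S_{ij}|=4$. Then there exist $a_{ij}\in\mathbb{N}$ ($i\in\{1,2,3,4\}$, $j\in\mathbb{N}$) such that the following hold: (1) $a_{ij}\in S_{ij}$ for all $i\in\{1,2,3,4\}$ and $j\in\mathbb{N}$; (2) for every $i\in\{1,2,3,4\}$: (a) $a_{i1},a_{i2},a_{i3}$ are mutually distinct, and (b) $a_{ij}\notin\{a_{i1},a_{i2}\}$ for all $j\geq 3$; (3) for all $r_1,r_2\in\{1,2,3,4\}$ with $r_1\neq r_2$ and all $j\in\mathbb{N}$, \[\{a_{r_1 1},a_{r_1 2},\ldots,a_{r_1 j}\}\neq\{a_{r_2 1},a_{r_2 2},\ldots,a_{r_2 j}\}.\]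
   Context: This is the case $n=3$, $k=4$ of the following general problem: given $n,k\in\mathbb{N}$ and sets $S_{ij}\subseteq\mathbb{N}$ with $|S_{ij}|=k$ for $i=1,\ldots,k$, $j\in\mathbb{N}$, find $a_{ij}\in S_{ij}$ such that in each row $a_{i1},\ldots,a_{in}$ are mutually distinct, $a_{ij}\notin\{a_{i1},\ldots,a_{i,n-1}\}$ for all $j\ge n$, and for distinct rows $r_1\neq r_2$ the sets of the first $j$ entries differ for every $j\in\mathbb{N}$. *)

theory Defs
  imports Main
begin

end

theory Submission
  imports Defs
begin

text \<open>
  Choose the first two entries so that the first entries are distinct and the pairs
  \<open>P i = {a i 1, a i 2}\<close> are distinct. From column 3 on, row \<open>i\<close> can avoid \<open>P i\<close> and one further
  element \<open>b i\<close>. Rows \<open>r\<close> and \<open>s\<close> are separated forever if \<open>b r \<in> P s\<close>. Alternatively they are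
  separated if row \<open>r\<close> cannot contain some element of \<open>P s\<close> before it contains \<open>b s\<close>, which
  row \<open>s\<close> never contains.

  If some pair \<open>P i\<close> meets two other pairs in its two different points, suitable elements \<open>b\<close>
  separate all rows in the first way. Otherwise every \<open>P i\<close> has a point \<open>p i\<close> in no other pair.
  Then the \<open>b i\<close> are chosen along a 4-cycle, which separates adjacent rows; and each of the
  two diagonals is separated in the second way by comparing the columns in which one of its
  rows is first forced.
\<close>

section \<open>Columns that force an element on a row\<close>

text \<open>
  A row that avoids \<open>P\<close> and \<open>b\<close> meets \<open>g\<close> before the first column that forces \<open>f\<close> on it.
\<close>

definition guarded :: "(nat \<Rightarrow> 'a set) \<Rightarrow> 'a set \<Rightarrow> 'a \<Rightarrow> 'a \<Rightarrow> 'a \<Rightarrow> bool" where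
  "guarded S P b f g \<longleftrightarrow> (\<forall>j\<ge>3. S j = P \<union> {b, f} \<longrightarrow> (\<exists>k\<ge>3. k < j \<and> g \<in> S k))"

lemma guarded_commute: "guarded S P b f g = guarded S P f b g"
  by (simp add: guarded_def insert_commute)

text \<open>Suppose columns \<open>j\<close> and \<open>k\<close> witness the failure of both
  alternatives. Neither precedes the other, since \<open>S j\<close> contains \<open>v\<close> and
  \<open>S k\<close> contains \<open>u\<close>; but \<open>j = k\<close> is impossible as
  \<open>u \<notin> S j\<close>.\<close>

lemma guarded_either:
  assumes "u \<notin> P" "u \<noteq> v" "u \<noteq> w"
  shows "guarded S P w v u \<or> guarded S P w u v"
proof (rule ccontr)
  assume "\<not> ?thesis"
  then obtain j k where j: "j \<ge> 3" "S j = P \<union> {w, v}" "\<And>i. i \<ge> 3 \<Longrightarrow> i < j \<Longrightarrow> u \<notin> S i"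
    and k: "k \<ge> 3" "S k = P \<union> {w, u}" "\<And>i. i \<ge> 3 \<Longrightarrow> i < k \<Longrightarrow> v \<notin> S i"
    unfolding guarded_def by meson
  have "u \<in> S k" "v \<in> S j" "u \<notin> S j"
    using j(2) k(2) assms by auto
  then show False
    using j k by (metis linorder_neqE_nat)
qed

text \<open>With \<open>f = b\<close> the forcing set has at most three elements, so no column
  equals it. Rows that rely on \<open>b\<close> alone are treated this way.\<close>

lemma guarded_same:
  assumes "card P \<le> 2" "\<And>j. j \<ge> 1 \<Longrightarrow> card (S j) = 4"
  shows "guarded S P b b g"
proof -
  have "card (P \<union> {b, b}) \<le> 3"
    using card_Un_le[of P "{b}"] assms(1) by simp
  then have "S j \<noteq> P \<union> {b, b}" if "j \<ge> 3" for j
    using assms(2)[of j] that by auto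
  then show ?thesis by (auto simp: guarded_def)
qed

section \<open>Greedy construction of the rows\<close>

text \<open>From column 3 on, take \<open>g\<close> whenever it is offered, and otherwise something
  other than \<open>f\<close> if possible. Then \<open>f\<close> enters without \<open>g\<close>
  only in a column equal to \<open>{x, y, b, f}\<close>, and by the guard \<open>g\<close> was
  offered, hence taken, before that.\<close>

lemma exists_row:
  fixes S :: "nat \<Rightarrow> 'a set"
  assumes card: "\<And>j. j \<ge> 1 \<Longrightarrow> card (S j) = 4"
    and xy: "x \<in> S 1" "y \<in> S 2" "x \<noteq> y"
    and b: "b \<notin> {x, y}" and g: "g \<notin> {x, y, b}" and f: "f \<notin> {x, y}"
    and guarded: "guarded S {x, y} b f g"
  shows "\<exists>a. a 1 = x \<and> a 2 = y \<and> (\<forall>j\<ge>1. a j \<in> S j) \<and> (\<forall>j\<ge>3. a j \<notin> {x, y}) \<and>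
    (\<forall>j\<ge>1. a j \<noteq> b) \<and> (\<forall>j. f \<in> a ` {1..j} \<longrightarrow> g \<in> a ` {1..j})"
proof -
  have ex: "\<exists>z. z \<in> S j \<and> z \<notin> {x, y, b} \<and> (g \<in> S j \<longrightarrow> z = g) \<and>
      (z = f \<longrightarrow> z = g \<or> S j = {x, y} \<union> {b, f})" if "j \<ge> 3" for j
  proof (cases "g \<in> S j")
    case True
    then show ?thesis using g by blast
  next
    case False
    have c4: "card (S j) = 4" and fin: "finite (S j)"
      using card[of j] that by (auto intro: card_ge_0_finite)
    show ?thesis
    proof (cases "S j \<subseteq> {x, y} \<union> {b, f}")
      case True
      have "card ({x, y} \<union> {b, f}) \<le> 4"
        using card_Un_le[of "{x, y}" "{b, f}"] card_insert_le_m1[of 2 "{y}" x]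
          card_insert_le_m1[of 2 "{f}" b] by simp
      then have eq: "S j = {x, y} \<union> {b, f}"
        using c4 True by (intro card_seteq) auto
      have "f \<noteq> b"
      proof
        assume "f = b"
        then have "S j = {x, y, b}" using eq by auto
        moreover have "card {x, y, b} = 3" using xy b by auto
        ultimately show False using c4 by simp
      qed
      then show ?thesis using eq False f by blast
    next
      case F: False
      then show ?thesis using False by blast
    qed
  qed
  define c where "c j = (SOME z. z \<in> S j \<and> z \<notin> {x, y, b} \<and> (g \<in> S j \<longrightarrow> z = g) \<and>
      (z = f \<longrightarrow> z = g \<or> S j = {x, y} \<union> {b, f}))" for j
  have c: "c j \<in> S j" "c j \<notin> {x, y, b}" "g \<in> S j \<Longrightarrow> c j = g"
      "c j = f \<Longrightarrow> c j = g \<or> S j = {x, y} \<union> {b, f}" if "j \<ge> 3" for j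
    using someI_ex[OF ex[OF that]] unfolding c_def[symmetric] by blast+
  define a where "a j = (if j = 1 then x else if j = 2 then y else c j)" for j :: nat
  have a3: "a j = c j" if "j \<ge> 3" for j
    using that by (auto simp: a_def)
  have small: "j = 1 \<or> j = 2 \<or> j \<ge> 3" if "j \<ge> 1" for j :: nat
    using that by linarith
  have a12: "a 1 = x" "a 2 = y" by (auto simp: a_def)
  have "a j \<in> S j \<and> a j \<noteq> b" if "j \<ge> 1" for j
    using small[OF that] a12 xy b c(1,2)[of j] a3[of j] by auto
  moreover have "g \<in> a ` {1..j}" if fj: "f \<in> a ` {1..j}" for j
  proof -
    obtain i where i: "1 \<le> i" "i \<le> j" "a i = f"
      using fj by auto
    then have i3: "i \<ge> 3"
      using small[of i] a12 f by auto
    then have "c i = f" using i a3 by simp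
    then consider "f = g" | "S i = {x, y} \<union> {b, f}"
      using c(4)[OF i3] by auto
    then show ?thesis
    proof cases
      case 1
      then show ?thesis using fj by simp
    next
      case 2
      then obtain k where k: "k \<ge> 3" "k < i" "g \<in> S k"
        using guarded i3 by (auto simp: guarded_def)
      then have "a k = g" using c(3) a3 by simp
      moreover have "k \<in> {1..j}" using k i by simp
      ultimately show ?thesis by blast
    qed
  qed
  ultimately show ?thesis
    using a12 a3 c(2) by (intro exI[of _ a]) auto
qed

text \<open>The rows are built independently of each other; all interaction between them is confined
  to \<open>sep\<close> and the injectivity of \<open>x\<close>, which settles
  \<open>j = 1\<close>.\<close>

lemma exists_rows:
  fixes S :: "'r \<Rightarrow> nat \<Rightarrow> 'a set"
  assumes card: "\<And>i j. i \<in> I \<Longrightarrow> j \<ge> 1 \<Longrightarrow> card (S i j) = 4"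
    and x: "\<And>i. i \<in> I \<Longrightarrow> x i \<in> S i 1" "inj_on x I"
    and y: "\<And>i. i \<in> I \<Longrightarrow> y i \<in> S i 2" "\<And>i. i \<in> I \<Longrightarrow> x i \<noteq> y i"
    and b: "\<And>i. i \<in> I \<Longrightarrow> b i \<notin> {x i, y i}"
    and f: "\<And>i. i \<in> I \<Longrightarrow> f i \<notin> {x i, y i}"
    and g: "\<And>i. i \<in> I \<Longrightarrow> g i \<notin> {x i, y i, b i}"
    and guarded: "\<And>i. i \<in> I \<Longrightarrow> guarded (S i) {x i, y i} (b i) (f i) (g i)"
    and sep: "\<And>r s. r \<in> I \<Longrightarrow> s \<in> I \<Longrightarrow> r \<noteq> s \<Longrightarrow> b r \<in> {x s, y s} \<or> b s \<in> {x r, y r} \<or>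
      (f r \<in> {x s, y s} \<and> g r = b s) \<or> (f s \<in> {x r, y r} \<and> g s = b r)"
  shows "\<exists>a. (\<forall>i\<in>I. \<forall>j\<ge>1. a i j \<in> S i j) \<and>
    (\<forall>i\<in>I. distinct [a i 1, a i 2, a i 3] \<and> (\<forall>j\<ge>3. a i j \<notin> {a i 1, a i 2})) \<and>
    (\<forall>r\<in>I. \<forall>s\<in>I. r \<noteq> s \<longrightarrow> (\<forall>j\<ge>1. a r ` {1..j} \<noteq> a s ` {1..j}))"
proof -
  have "\<forall>i\<in>I. \<exists>a. a 1 = x i \<and> a 2 = y i \<and> (\<forall>j\<ge>1. a j \<in> S i j) \<and>
      (\<forall>j\<ge>3. a j \<notin> {x i, y i}) \<and> (\<forall>j\<ge>1. a j \<noteq> b i) \<and>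
      (\<forall>j. f i \<in> a ` {1..j} \<longrightarrow> g i \<in> a ` {1..j})"
    using card x(1) y b g f guarded by (intro ballI exists_row) auto
  then obtain a where a: "\<And>i. i \<in> I \<Longrightarrow> a i 1 = x i \<and> a i 2 = y i \<and>
      (\<forall>j\<ge>1. a i j \<in> S i j) \<and> (\<forall>j\<ge>3. a i j \<notin> {x i, y i}) \<and> (\<forall>j\<ge>1. a i j \<noteq> b i) \<and>
      (\<forall>j. f i \<in> a i ` {1..j} \<longrightarrow> g i \<in> a i ` {1..j})"
    by metis
  have init: "{x i, y i} \<subseteq> a i ` {1..j}" if "i \<in> I" "j \<ge> 2" for i j
    using a[OF that(1)] that(2) by (auto intro: image_eqI[of _ _ "1::nat"] image_eqI[of _ _ "2::nat"])
  have avoid: "b i \<notin> a i ` {1..j}" if "i \<in> I" for i j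
    using a[OF that] by fastforce
  have separated: "a r ` {1..j} \<noteq> a s ` {1..j}"
    if "r \<in> I" "s \<in> I" "r \<noteq> s" "j \<ge> 1" for r s j
  proof (cases "j = 1")
    case True
    then show ?thesis using a that x(2) by (auto simp: inj_on_def)
  next
    case False
    then have "j \<ge> 2" using that by simp
    \<comment> \<open>Both prefixes now contain their pairs, so \<open>b r\<close> in the pair of
      \<open>s\<close> separates them. If instead \<open>f r\<close> lies in that pair and
      \<open>g r = b s\<close>, equal prefixes would put \<open>f r\<close>, hence
      \<open>b s\<close>, into row \<open>r\<close> and so into row \<open>s\<close>, which avoids
      it. The other alternatives exchange \<open>r\<close> and \<open>s\<close>.\<close>
    then show ?thesis
      using sep[OF that(1-3)] init[of r j] init[of s j] avoid[of r j] avoid[of s j] a[of r] a[of s] that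
      by (metis subsetD)
  qed
  have "distinct [a i 1, a i 2, a i 3] \<and> (\<forall>j\<ge>3. a i j \<notin> {a i 1, a i 2})" if "i \<in> I" for i
    using a[OF that] y(2)[OF that] by auto
  then show ?thesis
    using a separated by (intro exI[of _ a] conjI) (simp_all)
qed

section \<open>Choice of the first two columns\<close>

text \<open>Since first entries are distinct, two pairs coincide only if each second entry is the
  first entry of the other row. Forbidding one of these two equalities for every two rows suffices,
  and this can be arranged with at most three forbidden values per entry.\<close>

lemma exists_initial_pairs:
  fixes X Y :: "nat \<Rightarrow> 'a set"
  assumes X: "\<And>i. i \<in> {1..4} \<Longrightarrow> card (X i) = 4" and Y: "\<And>i. i \<in> {1..4} \<Longrightarrow> card (Y i) = 4"
  shows "\<exists>x y. (\<forall>i\<in>{1..4}. x i \<in> X i \<and> y i \<in> Y i \<and> x i \<noteq> y i) \<and>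
    inj_on x {1..4} \<and> inj_on (\<lambda>i. {x i, y i}) {1..4}"
proof -
  have pick: "\<exists>z\<in>A. z \<notin> set zs" if "card A = 4" "length zs \<le> 3" for A :: "'a set" and zs
  proof (rule ccontr)
    assume "\<not> ?thesis"
    then have "card A \<le> card (set zs)" by (intro card_mono) auto
    then show False using that card_length[of zs] by simp
  qed
  have rows: "card (X 1) = 4" "card (X 2) = 4" "card (X 3) = 4" "card (X 4) = 4"
    "card (Y 1) = 4" "card (Y 2) = 4" "card (Y 3) = 4" "card (Y 4) = 4"
    using X Y by auto
  obtain x1 where x1: "x1 \<in> X 1" using pick[OF rows(1), of "[]"] by auto
  obtain x2 where x2: "x2 \<in> X 2" "x2 \<noteq> x1" using pick[OF rows(2), of "[x1]"] by auto
  obtain x3 where x3: "x3 \<in> X 3" "x3 \<noteq> x1" "x3 \<noteq> x2"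
    using pick[OF rows(3), of "[x1, x2]"] by auto
  obtain x4 where x4: "x4 \<in> X 4" "x4 \<noteq> x1" "x4 \<noteq> x2" "x4 \<noteq> x3"
    using pick[OF rows(4), of "[x1, x2, x3]"] by auto
  txt \<open>Keeping \<open>x4\<close> out of the first pair leaves only two pairs to avoid in row 4.\<close>
  obtain y1 where y1: "y1 \<in> Y 1" "y1 \<noteq> x1" "y1 \<noteq> x4"
    using pick[OF rows(5), of "[x1, x4]"] by auto
  obtain y2 where y2: "y2 \<in> Y 2" "y2 \<noteq> x2" "y2 \<noteq> x1"
    using pick[OF rows(6), of "[x2, x1]"] by auto
  obtain y3 where y3: "y3 \<in> Y 3" "y3 \<noteq> x3" "y3 \<noteq> x1" "y3 \<noteq> x2"
    using pick[OF rows(7), of "[x3, x1, x2]"] by auto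
  obtain y4 where y4: "y4 \<in> Y 4" "y4 \<noteq> x4" "y4 \<noteq> x2" "y4 \<noteq> x3"
    using pick[OF rows(8), of "[x4, x2, x3]"] by auto
  define x where "x = (\<lambda>_ :: nat. x4)(1 := x1, 2 := x2, 3 := x3)"
  define y where "y = (\<lambda>_ :: nat. y4)(1 := y1, 2 := y2, 3 := y3)"
  have "{1..4} = {1, 2, 3, 4 :: nat}" by auto
  then show ?thesis
    using x1 x2 x3 x4 y1 y2 y3 y4
    by (intro exI[of _ x] exI[of _ y]) (auto simp: x_def y_def doubleton_eq_iff)
qed

section \<open>A pair that meets two other pairs\<close>

lemma card_4_remaining:
  assumes "card I = 4" "i \<in> I" "s \<in> I" "t \<in> I" "distinct [i, s, t]"
  obtains k where "I = {i, s, t, k}" "distinct [i, s, t, k]"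
proof -
  have "card (I - {i, s, t}) = 1"
    using assms by (subst card_Diff_subset) auto
  then obtain k where k: "I - {i, s, t} = {k}"
    by (auto simp: card_1_singleton_iff)
  then have "I = {i, s, t, k}"
    using assms(2-4) by blast
  moreover have "k \<notin> {i, s, t}"
    using k by blast
  ultimately show ?thesis
    using assms(5) by (intro that[of k]) auto
qed

text \<open>A row that avoids \<open>u\<close> or \<open>v\<close> is separated from two rows at
  once, as each of these points lies in two pairs. Distinct pairs of size two cannot contain one
  another, so \<open>P k\<close> misses \<open>u\<close> or \<open>v\<close>.\<close>

lemma exists_avoiding_of_meeting_pair:
  assumes I: "I = {i, s, t, k}" "distinct [i, s, t, k]"
    and P: "inj_on P I" "\<And>i. i \<in> I \<Longrightarrow> card (P i) = 2"
    and uv: "P i = {u, v}" "u \<in> P s" "v \<in> P t"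
  shows "\<exists>b. (\<forall>r\<in>I. b r \<notin> P r) \<and> (\<forall>r\<in>I. \<forall>s\<in>I. r \<noteq> s \<longrightarrow> b r \<in> P s \<or> b s \<in> P r)"
proof -
  have diff: "\<exists>z\<in>P r. z \<notin> P q" if "r \<in> I" "q \<in> I" "r \<noteq> q" for r q
  proof (rule ccontr)
    assume "\<not> ?thesis"
    then have "P r = P q"
      using P(2)[OF that(1)] P(2)[OF that(2)] by (intro card_seteq) (auto intro: card_ge_0_finite)
    then show False using P(1) that by (auto dest: inj_onD)
  qed
  have "u \<notin> P t"
    using diff[of i t] I uv by auto
  have "v \<notin> P s"
    using diff[of i s] I uv by auto
  consider "u \<notin> P k" | "v \<notin> P k"
    using diff[of i k] I uv by auto
  then show ?thesis
  proof cases
    case 1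
    obtain z where z: "z \<in> P k" "z \<notin> P t" using diff[of k t] I by auto
    obtain w where w: "w \<in> P t" "w \<notin> P i" using diff[of t i] I by auto
    \<comment> \<open>Row \<open>s\<close> avoids \<open>v\<close>, which handles \<open>i\<close>
      and \<open>t\<close>; row \<open>k\<close> avoids \<open>u\<close>, which handles
      \<open>i\<close> and \<open>s\<close>. The rest is \<open>i\<close> against \<open>t\<close>
      by \<open>w\<close>, and \<open>t\<close> against \<open>k\<close> by
      \<open>z\<close>.\<close>
    show ?thesis
      using 1 z w uv I \<open>v \<notin> P s\<close>
      by (intro exI[of _ "(\<lambda>_. u)(i := w, s := v, t := z)"]) auto
  next
    case 2
    \<comment> \<open>The first case with \<open>s\<close>, \<open>t\<close> and \<open>u\<close>,
      \<open>v\<close> exchanged.\<close>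
    obtain z where z: "z \<in> P k" "z \<notin> P s" using diff[of k s] I by auto
    obtain w where w: "w \<in> P s" "w \<notin> P i" using diff[of s i] I by auto
    show ?thesis
      using 2 z w uv I \<open>u \<notin> P t\<close>
      by (intro exI[of _ "(\<lambda>_. v)(i := w, t := u, s := z)"]) auto
  qed
qed

section \<open>Separation by avoided elements alone, or by private points and guards\<close>

theorem theorem2p1:
  fixes S :: "nat \<Rightarrow> nat \<Rightarrow> nat set"
  assumes "\<And>i j. i \<in> {1..4} \<Longrightarrow> j \<ge> 1 \<Longrightarrow> card (S i j) = 4"
  shows "\<exists>a :: nat \<Rightarrow> nat \<Rightarrow> nat.
    (\<forall>i\<in>{1..4}. \<forall>j\<ge>1. a i j \<in> S i j) \<and>
    (\<forall>i\<in>{1..4}. distinct [a i 1, a i 2, a i 3] \<and> (\<forall>j\<ge>3. a i j \<notin> {a i 1, a i 2})) \<and>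
    (\<forall>r1\<in>{1..4}. \<forall>r2\<in>{1..4}. r1 \<noteq> r2 \<longrightarrow>
      (\<forall>j\<ge>1. a r1 ` {1..j} \<noteq> a r2 ` {1..j}))"
proof -
  have "\<exists>x y. (\<forall>i\<in>{1..4}. x i \<in> S i 1 \<and> y i \<in> S i 2 \<and> x i \<noteq> y i) \<and>
      inj_on x {1..4} \<and> inj_on (\<lambda>i. {x i, y i}) {1..4}"
    by (rule exists_initial_pairs) (simp_all add: assms)
  then obtain x y where xy: "\<And>i. i \<in> {1..4} \<Longrightarrow> x i \<in> S i 1 \<and> y i \<in> S i 2 \<and> x i \<noteq> y i"
    and inj: "inj_on x {1..4}" "inj_on (\<lambda>i. {x i, y i}) {1..4}"
    by blast
  define P where "P i = {x i, y i}" for i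
  have inj_P: "inj_on P {1..4}"
    using inj(2) by (simp add: P_def inj_on_def)
  have P2: "card (P i) = 2" if "i \<in> {1..4}" for i
    using xy[OF that] by (simp add: P_def)
  have fresh: "\<exists>h. \<forall>i. h i \<notin> P i \<union> {w i}" for w
    by (intro choice allI ex_new_if_finite) (auto simp: P_def)
  have static: "guarded (S i) (P i) w w z" if "i \<in> {1..4}" for i w z
    using guarded_same[of "P i" "S i"] P2[OF that] assms[OF that] by auto
  show ?thesis
  proof (cases "\<exists>b. (\<forall>r\<in>{1..4}. b r \<notin> P r) \<and>
      (\<forall>r\<in>{1..4}. \<forall>s\<in>{1..4}. r \<noteq> s \<longrightarrow> b r \<in> P s \<or> b s \<in> P r)")
    case True
    then obtain b where b: "\<And>r. r \<in> {1..4} \<Longrightarrow> b r \<notin> P r"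
      "\<And>r s. r \<in> {1..4} \<Longrightarrow> s \<in> {1..4} \<Longrightarrow> r \<noteq> s \<Longrightarrow> b r \<in> P s \<or> b s \<in> P r"
      by blast
    obtain g where g: "\<And>i. g i \<notin> P i \<union> {b i}"
      using fresh by blast
    \<comment> \<open>Setting \<open>f = b\<close> makes every guard vacuous, and \<open>g\<close>
      is merely some fresh value.\<close>
    show ?thesis
    proof (rule exists_rows[where x = x and y = y and b = b and f = b and g = g])
      show "guarded (S i) {x i, y i} (b i) (b i) (g i)" if "i \<in> {1..4}" for i
        using static[OF that] by (simp add: P_def)
      show "b r \<in> {x s, y s} \<or> b s \<in> {x r, y r} \<or>
          (b r \<in> {x s, y s} \<and> g r = b s) \<or> (b s \<in> {x r, y r} \<and> g s = b r)"
        if "r \<in> {1..4}" "s \<in> {1..4}" "r \<noteq> s" for r s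
        using b(2)[OF that] by (auto simp: P_def)
    qed (use assms xy inj b g in \<open>auto simp: P_def\<close>)
  next
    case nomeet: False
    \<comment> \<open>If both points of \<open>P i\<close> were shared, they would be shared with
      two different rows because the pairs are distinct, and the meeting-pair lemma would supply the
      excluded \<open>b\<close>.\<close>
    have "\<exists>p\<in>P i. \<forall>r\<in>{1..4}. r \<noteq> i \<longrightarrow> p \<notin> P r" if i: "i \<in> {1..4}" for i
    proof (rule ccontr)
      assume "\<not> ?thesis"
      then obtain s t where st: "s \<in> {1..4}" "s \<noteq> i" "x i \<in> P s" "t \<in> {1..4}" "t \<noteq> i" "y i \<in> P t"
        by (auto simp: P_def)
      have "s \<noteq> t"
      proof
        assume "s = t"
        then have "P i = P s" using st P2 xy[OF i] by (auto simp: P_def)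
        then show False using inj(2) i st by (auto simp: P_def inj_on_def)
      qed
      then obtain k where k: "{1..4} = {i, s, t, k}" "distinct [i, s, t, k]"
        using card_4_remaining[of "{1..4::nat}" i s t] i st by auto
      show False
        using nomeet exists_avoiding_of_meeting_pair[OF k inj_P P2 P_def st(3,6)] by (rule notE)
    qed
    then obtain p where p: "\<And>i. i \<in> {1..4} \<Longrightarrow> p i \<in> P i"
      "\<And>i r. i \<in> {1..4} \<Longrightarrow> r \<in> {1..4} \<Longrightarrow> r \<noteq> i \<Longrightarrow> p i \<notin> P r"
      by metis
    have choose: "guarded (S r) (P r) (p w) (p v) (p u) \<or> guarded (S r) (P r) (p w) (p u) (p v)"
      if "{r, u, v, w} \<subseteq> {1..4}" "distinct [r, u, v, w]" for r u v w
    proof (rule guarded_either)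
      show "p u \<notin> P r" using p that by auto
      show "p u \<noteq> p v" "p u \<noteq> p w" using p[of u] p[of v] p[of w] that by force+
    qed
    \<comment> \<open>In the cyclic order \<open>c\<close>, \<open>e\<close>, \<open>d\<close>,
      \<open>a\<close> each row avoids the private point of the next. For the diagonals, row
      \<open>c\<close> cannot contain \<open>p d\<close> without \<open>p a = b d\<close>, and row
      \<open>a\<close> cannot contain \<open>p e\<close> without \<open>p d = b e\<close>.\<close>
    have cycle: ?thesis if I: "{1..4} = {c, a, d, e}" and dist: "distinct [c, a, d, e]"
      and gc: "guarded (S c) (P c) (p e) (p d) (p a)" and ga: "guarded (S a) (P a) (p c) (p e) (p d)"
    for c a d e
    proof -
      \<comment> \<open>The default value \<open>p e\<close> serves row \<open>c\<close>. Each
        diagonal is settled by \<open>c\<close> or \<open>a\<close>, so below only these rows get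
        their own \<open>f\<close> and \<open>g\<close>; rows \<open>d\<close> and \<open>e\<close>
        keep \<open>f = b\<close> and a fresh \<open>g\<close>.\<close>
      define b where "b = (\<lambda>_. p e)(a := p c, d := p a, e := p d)"
      define f where "f = b(c := p d, a := p e)"
      obtain g0 where g0: "\<And>i. g0 i \<notin> P i \<union> {b i}" using fresh by blast
      define g where "g = g0(c := p a, a := p d)"
      have mem: "c \<in> {1..4}" "a \<in> {1..4}" "d \<in> {1..4}" "e \<in> {1..4}"
        unfolding I by auto
      have neq: "p c \<noteq> p d" "p e \<noteq> p a"
        using p mem dist by (metis distinct_length_2_or_more)+
      have notin: "p a \<notin> P c" "p d \<notin> P c" "p e \<notin> P c" "p c \<notin> P a" "p d \<notin> P a" "p e \<notin> P a"
        "p a \<notin> P d" "p d \<notin> P e"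
        by (rule p(2)[OF mem(2,1)] p(2)[OF mem(3,1)] p(2)[OF mem(4,1)] p(2)[OF mem(1,2)]
            p(2)[OF mem(3,2)] p(2)[OF mem(4,2)] p(2)[OF mem(2,3)] p(2)[OF mem(3,4)],
            use dist in simp)+
      have vals: "b c = p e" "b a = p c" "b d = p a" "b e = p d"
        "f c = p d" "f a = p e" "f d = p a" "f e = p d"
        "g c = p a" "g a = p d" "g d = g0 d" "g e = g0 e"
        using dist by (auto simp: b_def f_def g_def)
      show ?thesis
      proof (rule exists_rows[where x = x and y = y and b = b and f = f and g = g])
        fix i :: nat assume i: "i \<in> {1..4}"
        then have i': "i \<in> {c, a, d, e}" unfolding I .
        have "b i \<notin> P i \<and> f i \<notin> P i"
          using i' dist notin by (elim insertE emptyE) (simp_all add: vals)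
        then show "b i \<notin> {x i, y i}" "f i \<notin> {x i, y i}"
          unfolding P_def by blast+
        have "g i \<notin> P i \<union> {b i}"
          using i' g0[of d] g0[of e] notin(1,5) neq
          by (elim insertE emptyE) (simp_all add: vals)
        then show "g i \<notin> {x i, y i, b i}"
          by (simp add: P_def)
        have "guarded (S i) (P i) (b i) (f i) (g i)"
          using i' gc ga static[OF i] by (elim insertE emptyE) (simp_all add: vals)
        then show "guarded (S i) {x i, y i} (b i) (f i) (g i)"
          unfolding P_def .
      next
        fix r s :: nat assume rs: "r \<in> {1..4}" "s \<in> {1..4}" "r \<noteq> s"
        have "p i \<in> P i" if "i \<in> {c, a, d, e}" for i
          using p(1) that unfolding I .
        then have "b r \<in> P s \<or> b s \<in> P r \<or>
            (f r \<in> P s \<and> g r = b s) \<or> (f s \<in> P r \<and> g s = b r)"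
          using rs vals unfolding I by (elim insertE emptyE) simp_all
        then show "b r \<in> {x s, y s} \<or> b s \<in> {x r, y r} \<or>
            (f r \<in> {x s, y s} \<and> g r = b s) \<or> (f s \<in> {x r, y r} \<and> g s = b r)"
          unfolding P_def .
      qed (use assms xy inj in auto)
    qed
    \<comment> \<open>Exchanging \<open>d\<close> and \<open>e\<close> preserves the condition on
      row \<open>c\<close>, by the symmetry of \<open>guarded\<close> in \<open>b\<close> and
      \<open>f\<close>, and turns one alternative for row \<open>a\<close> into the other.\<close>
    have branch: ?thesis if "{1..4} = {c, a, d, e}" "distinct [c, a, d, e]"
      "guarded (S c) (P c) (p e) (p d) (p a)" for c a d e
    proof -
      have sub: "{a, d, e, c} \<subseteq> {1..4}" "distinct [a, d, e, c]"
        using that(2) unfolding that(1) by auto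
      have perm: "{1..4} = {c, a, e, d}" "distinct [c, a, e, d]"
        using that(1,2) by auto
      from choose[OF sub] show ?thesis
      proof
        assume "guarded (S a) (P a) (p c) (p e) (p d)"
        then show ?thesis by (rule cycle[OF that])
      next
        assume "guarded (S a) (P a) (p c) (p d) (p e)"
        then show ?thesis using that(3)
          by (intro cycle[OF perm]) (simp_all only: guarded_commute[of "S c" "P c"])
      qed
    qed
    have "{1, 2, 3, 4} \<subseteq> {1..4::nat}" "distinct [1, 2, 3, 4 :: nat]"
      by auto
    \<comment> \<open>The alternative that holds for row 1 decides whether row 2 or row 3 plays the
      part of \<open>a\<close>.\<close>
    from choose[OF this] show ?thesis
    proof
      assume "guarded (S 1) (P 1) (p 4) (p 3) (p 2)"
      then show ?thesis by (intro branch[of 1 2 3 4]) auto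
    next
      assume "guarded (S 1) (P 1) (p 4) (p 2) (p 3)"
      then show ?thesis by (intro branch[of 1 3 2 4]) auto
    qed
  qed
qed

end
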